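(* Let $X$ be a non-empty countably based perfect $T_D$-space with countably many points. Then $X$ contains a perfect $\mathbf{\Delta}^0_2$-subspace (i.e. a set $S\in\mathbf{\Delta}^0_2(X)$ which is perfect in the subspace topology) homeomorphic to either $S_D$, $S_1$, or $S_2$.
   Context: Countably based means second countable. For a topological space $X$, $\mathbf{\Sigma}^0_2(X)$ is the set of all subsets of the form $\bigcup_{i\in\omega}U_i\setminus V_i$ with $U_i,V_i\subseteq X$ open; $\mathbf{\Pi}^0_2(X)$ is the set of complements of members of $\mathbf{\Sigma}^0_2(X)$; and $\mathbf{\Delta}^0_2(X)=\mathbf{\Sigma}^0_2(X)\cap\mathbf{\Pi}^0_2(X)$. A subset is locally closed if it is the intersection of an open set with a closed set. A $T_D$-space is a space in which every singleton subset is locally closed. A space is perfect if every non-empty open subset is infinite. $S_2$ is the set of rational numbers with the subspace topology from the reals; $S_1$ is the set of natural numbers with the cofinite topology; $S_D$ is the set of natural numbers with the topology whose non-empty open sets are exactly the sets $\{m\in\omega : n\leq m\}$, $n\in\omega$. *)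

theory Defs
  imports "HOL-Analysis.Analysis"
begin

definition Sigma02 :: "'a topology \<Rightarrow> 'a set set" where
  "Sigma02 X = {\<Union>i::nat. U i - V i | U V. (\<forall>i. openin X (U i)) \<and> (\<forall>i. openin X (V i))}"

definition Pi02 :: "'a topology \<Rightarrow> 'a set set" where
  "Pi02 X = {topspace X - A | A. A \<in> Sigma02 X}"

definition Delta02 :: "'a topology \<Rightarrow> 'a set set" where
  "Delta02 X = Sigma02 X \<inter> Pi02 X"

definition locally_closedin :: "'a topology \<Rightarrow> 'a set \<Rightarrow> bool" where
  "locally_closedin X A \<longleftrightarrow> (\<exists>U C. openin X U \<and> closedin X C \<and> A = U \<inter> C)"

definition TD_space :: "'a topology \<Rightarrow> bool" where
  "TD_space X \<longleftrightarrow> (\<forall>x \<in> topspace X. locally_closedin X {x})"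

(* The library type class perfect_space only requires that no singleton is open; this is
   weaker than the notion below when the space is not T1. *)
definition perfect_topology :: "'a topology \<Rightarrow> bool" where
  "perfect_topology X \<longleftrightarrow> (\<forall>U. openin X U \<and> U \<noteq> {} \<longrightarrow> infinite U)"

definition S_D :: "nat topology" where
  "S_D = topology (\<lambda>U. U = {} \<or> (\<exists>n. U = {m. n \<le> m}))"

definition S_1 :: "nat topology" where
  "S_1 = topology (\<lambda>U. U = {} \<or> finite (UNIV - U))"

definition S_2 :: "real topology" where
  "S_2 = subtopology euclideanreal \<rat>"

lemma openin_S_D: "openin S_D U \<longleftrightarrow> U = {} \<or> (\<exists>n. U = {m. n \<le> m})"
proof -
  have eq: "(U = {} \<or> (\<exists>n. U = {m. n \<le> m})) = (\<forall>x y. x \<in> U \<longrightarrow> x \<le> y \<longrightarrow> y \<in> U)" for U :: "nat set"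
  proof
    assume "U = {} \<or> (\<exists>n. U = {m. n \<le> m})"
    then show "\<forall>x y. x \<in> U \<longrightarrow> x \<le> y \<longrightarrow> y \<in> U"
      using order_trans by blast
  next
    assume up: "\<forall>x y. x \<in> U \<longrightarrow> x \<le> y \<longrightarrow> y \<in> U"
    show "U = {} \<or> (\<exists>n. U = {m. n \<le> m})"
    proof (cases "U = {}")
      case False
      define n where "n = (LEAST x. x \<in> U)"
      have "n \<in> U"
        using False unfolding n_def by (metis LeastI ex_in_conv)
      moreover have "n \<le> m" if "m \<in> U" for m
        using that unfolding n_def by (rule Least_le)
      ultimately have "U = {m. n \<le> m}"
        using up by blast
      then show ?thesis by blast
    qed simp
  qed
  have "istopology (\<lambda>U::nat set. \<forall>x y. x \<in> U \<longrightarrow> x \<le> y \<longrightarrow> y \<in> U)"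
    unfolding istopology_def by blast
  then show ?thesis
    unfolding S_D_def eq by (rule topology_inverse'[THEN fun_cong])
qed

lemma topspace_S_D [simp]: "topspace S_D = UNIV"
proof -
  have "openin S_D UNIV"
    unfolding openin_S_D by (intro disjI2 exI[of _ 0]) auto
  then show ?thesis
    using openin_subset by blast
qed

lemma openin_S_1: "openin S_1 U \<longleftrightarrow> U = {} \<or> finite (UNIV - U)"
proof -
  have "istopology (\<lambda>U::nat set. U = {} \<or> finite (UNIV - U))"
    unfolding istopology_def
  proof (intro conjI allI impI)
    fix S T :: "nat set"
    assume "S = {} \<or> finite (UNIV - S)" "T = {} \<or> finite (UNIV - T)"
    then show "S \<inter> T = {} \<or> finite (UNIV - S \<inter> T)"
      by (auto simp: Diff_Int)
  next
    fix K :: "nat set set"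
    assume K: "\<forall>S\<in>K. S = {} \<or> finite (UNIV - S)"
    show "\<Union>K = {} \<or> finite (UNIV - \<Union>K)"
    proof (cases "\<Union>K = {}")
      case False
      then obtain S where "S \<in> K" "S \<noteq> {}" by blast
      moreover have "UNIV - \<Union>K \<subseteq> UNIV - S" using \<open>S \<in> K\<close> by blast
      ultimately show ?thesis using K finite_subset by blast
    qed auto
  qed
  then show ?thesis
    unfolding S_1_def by (rule topology_inverse'[THEN fun_cong])
qed

lemma topspace_S_1 [simp]: "topspace S_1 = UNIV"
proof -
  have "openin S_1 UNIV"
    unfolding openin_S_1 by simp
  then show ?thesis
    using openin_subset by blast
qed

end

theory Submission
  imports Defs
begin

text \<open>In a countable TD space every subset is \<open>\<Delta>\<^sup>0\<^sub>2\<close>, so only the homeomorphism type of the subspace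
  matters. An infinite strictly ascending chain of the specialization order is a copy of \<open>S\<^sub>D\<close>.
  Without such chains every point lies below a maximal one, and the maximal points form a perfect
  T1 subspace. There, call a point clinging if it has an open neighbourhood B in which each of its
  neighbourhoods is dense. If clinging points are dense, nested choices yield a sequence converging
  to each of its terms, which is a copy of \<open>S\<^sub>1\<close>. Otherwise some non-empty open set has no
  clinging points, and in it a tree of points can be chosen in which the subtrees at the children of
  a node are separated by disjoint open sets and converge to that node. The rationals are exhausted
  by such a tree, and the tree alone determines the topology.\<close>

section \<open>Homeomorphisms between indexed subspaces\<close>

text \<open>Over a common index type both topologies become families of index sets, and the
  bijection \<open>h \<circ> inv g\<close> is a homeomorphism as soon as these families agree. All
  copies of the model spaces are recognised in this way.\<close>

lemma homeomorphic_space_indexed: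
  assumes g: "inj g" "range g \<subseteq> topspace X" and h: "inj h" "range h \<subseteq> topspace Y"
    and eq: "\<And>A. openin (subtopology X (range g)) (g ` A) \<longleftrightarrow> openin (subtopology Y (range h)) (h ` A)"
  shows "subtopology X (range g) homeomorphic_space subtopology Y (range h)"
proof -
  let ?f = "\<lambda>a. h (inv g a)"
  have f: "?f (g i) = h i" for i
    by (simp add: g(1))
  have im: "?f ` (g ` A) = h ` A" for A
    by (auto simp: f image_iff)
  have tg: "topspace (subtopology X (range g)) = range g"
    and th: "topspace (subtopology Y (range h)) = range h"
    using g h by (auto simp: topspace_subtopology)
  have "homeomorphic_map (subtopology X (range g)) (subtopology Y (range h)) ?f"
    unfolding homeomorphic_map_def quotient_map_def tg th
  proof (intro conjI allI impI)
    show "?f ` range g = range h"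
      by (rule im)
    show "inj_on ?f (range g)"
      unfolding inj_on_def using g(1) h(1) by (auto simp: inj_eq)
  next
    fix U assume "U \<subseteq> range h"
    then obtain A where A: "U = h ` A"
      by (auto simp: subset_image_iff)
    then have "{x \<in> range g. ?f x \<in> U} = g ` A"
      using h(1) by (auto simp: f inj_eq)
    then show "openin (subtopology X (range g)) {x \<in> range g. ?f x \<in> U} \<longleftrightarrow> openin (subtopology Y (range h)) U"
      by (simp only: A eq)
  qed
  then show ?thesis
    by (rule homeomorphic_map_imp_homeomorphic_space)
qed

lemma perfect_topology_homeomorphic:
  assumes "X homeomorphic_space Y" "perfect_topology Y"
  shows "perfect_topology X"
proof -
  obtain f where f: "homeomorphic_map X Y f"
    using assms(1) homeomorphic_space by blast
  show ?thesis
    unfolding perfect_topology_def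
  proof (intro allI impI)
    fix U assume U: "openin X U \<and> U \<noteq> {}"
    then have "openin Y (f ` U)"
      using f homeomorphic_map_openness openin_subset by blast
    then have "infinite (f ` U)"
      using U assms(2) unfolding perfect_topology_def by blast
    then show "infinite U"
      by blast
  qed
qed

section \<open>Perfectness of the three model spaces\<close>

lemma perfect_S_D: "perfect_topology S_D"
  unfolding perfect_topology_def openin_S_D
  using infinite_Ici by (auto simp flip: atLeast_def)

lemma perfect_S_1: "perfect_topology S_1"
  unfolding perfect_topology_def openin_S_1
  using finite_Diff2 infinite_UNIV_nat by blast

lemma perfect_S_2: "perfect_topology S_2"
  unfolding perfect_topology_def S_2_def
proof (intro allI impI)
  fix U :: "real set"
  assume U: "openin (subtopology euclideanreal \<rat>) U \<and> U \<noteq> {}"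
  then obtain T where T: "open T" "U = T \<inter> \<rat>"
    by (auto simp: openin_subtopology)
  then obtain x where "x \<in> T"
    using U by blast
  show "infinite U"
  proof
    assume fin: "finite U"
    \<comment> \<open>Removing a finite \<open>U\<close> would leave a non-empty open set of reals
      without rationals.\<close>
    have "open (T - U)"
      using T fin by (simp add: finite_imp_closed open_Diff)
    moreover have "T - U \<noteq> {}"
    proof
      assume "T - U = {}"
      then have "finite T"
        using fin by (simp add: finite_subset)
      then show False
        using T(1) \<open>x \<in> T\<close> finite_imp_not_open by blast
    qed
    ultimately obtain y e where "0 < e" "ball y e \<subseteq> T - U"
      by (metis ex_in_conv openE)
    moreover obtain q where "q \<in> \<rat>" "y < q" "q < y + e"
      using Rats_dense_in_real[of y "y + e"] \<open>0 < e\<close> by auto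
    ultimately show False
      using T(2) by (auto simp: ball_def dist_real_def subset_iff)
  qed
qed

section \<open>Delta02 subsets of countable TD spaces\<close>

text \<open>Local closedness makes each singleton a difference of two open sets, and an enumeration
  of \<open>S\<close>, possibly with repetitions, unites them. The enumeration requires
  \<open>S\<close> to be non-empty, hence the case distinction.\<close>

lemma Sigma02_countable_TD:
  assumes "TD_space X" "countable (topspace X)" "S \<subseteq> topspace X"
  shows "S \<in> Sigma02 X"
proof (cases "S = {}")
  case True
  have "S = (\<Union>i::nat. {} - {})"
    using True by simp
  then show ?thesis
    unfolding Sigma02_def by (intro CollectI exI[of _ "\<lambda>_. {}"]) auto
next
  case False
  have "countable S"
    using assms countable_subset by blast
  define p where "p = from_nat_into S"
  have p: "range p = S"
    using False \<open>countable S\<close> by (simp add: p_def)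
  have "\<exists>U V. openin X U \<and> openin X V \<and> {p i} = U - V" for i
  proof -
    have "p i \<in> topspace X"
      using p assms(3) by blast
    then obtain U C where "openin X U" "closedin X C" "{p i} = U \<inter> C"
      using assms(1) unfolding TD_space_def locally_closedin_def by blast
    then have "openin X U \<and> openin X (topspace X - C) \<and> {p i} = U - (topspace X - C)"
      using openin_subset[of X U] by auto
    then show ?thesis by blast
  qed
  then obtain U V where UV: "\<And>i. openin X (U i)" "\<And>i. openin X (V i)" "\<And>i. {p i} = U i - V i"
    by metis
  have "S = (\<Union>i. U i - V i)"
    unfolding UV(3)[symmetric] using p by auto
  then show ?thesis
    unfolding Sigma02_def using UV by blast
qed

lemma Delta02_countable_TD:
  assumes "TD_space X" "countable (topspace X)" "S \<subseteq> topspace X"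
  shows "S \<in> Delta02 X"
proof -
  have "S = topspace X - (topspace X - S)"
    using assms(3) by blast
  moreover have "topspace X - S \<in> Sigma02 X"
    using Sigma02_countable_TD[OF assms(1,2)] by blast
  ultimately show ?thesis
    unfolding Delta02_def Pi02_def using Sigma02_countable_TD[OF assms] by blast
qed

section \<open>Chains and maximal points of the specialization order\<close>

text \<open>Every neighbourhood of the smaller point contains the larger one. In a TD space the
  preorder is antisymmetric, so excluding equality yields its strict part.\<close>

definition specialization_less :: "'a topology \<Rightarrow> 'a \<Rightarrow> 'a \<Rightarrow> bool" where
  "specialization_less X x y \<longleftrightarrow> x \<noteq> y \<and> x \<in> X closure_of {y}"

lemma closure_of_singleton_iff:
  "x \<in> X closure_of {y} \<longleftrightarrow> x \<in> topspace X \<and> (\<forall>T. openin X T \<and> x \<in> T \<longrightarrow> y \<in> T)"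
  by (auto simp: in_closure_of)

lemma closure_of_singleton_trans:
  "x \<in> X closure_of {y} \<Longrightarrow> y \<in> X closure_of {z} \<Longrightarrow> x \<in> X closure_of {z}"
  by (simp add: closure_of_singleton_iff)

text \<open>The closed set witnessing local closedness may be shrunk to the closure of
  \<open>x\<close>, so some neighbourhood of \<open>x\<close> contains no point strictly below
  \<open>x\<close>.\<close>

lemma TD_space_nbhd:
  assumes "TD_space X" "x \<in> topspace X"
  obtains U where "openin X U" "x \<in> U" "U \<inter> X closure_of {x} = {x}"
proof -
  obtain U C where UC: "openin X U" "closedin X C" "{x} = U \<inter> C"
    using assms unfolding TD_space_def locally_closedin_def by blast
  then have "X closure_of {x} \<subseteq> C"
    by (intro closure_of_minimal) auto
  moreover have "x \<in> X closure_of {x}"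
    using assms(2) by (simp add: closure_of_singleton_iff)
  ultimately have "U \<inter> X closure_of {x} = {x}"
    using UC by blast
  then show ?thesis
    using that UC by blast
qed

lemma closure_of_singleton_antisym:
  assumes "TD_space X" "x \<in> X closure_of {y}" "y \<in> X closure_of {x}"
  shows "x = y"
proof -
  have "x \<in> topspace X"
    using assms(2) by (simp add: closure_of_singleton_iff)
  then obtain U where U: "openin X U" "x \<in> U" "U \<inter> X closure_of {x} = {x}"
    using TD_space_nbhd assms(1) by metis
  have "y \<in> U"
    using assms(2) U(1,2) unfolding closure_of_singleton_iff by blast
  then have "y \<in> U \<inter> X closure_of {x}"
    using assms(3) by blast
  then show ?thesis
    using U(3) by simp
qed

lemma openin_S_D_if_upward:
  assumes up: "\<And>m n. m \<in> A \<Longrightarrow> m \<le> n \<Longrightarrow> n \<in> A"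
  shows "openin S_D A"
proof (cases "A = {}")
  case False
  define k where "k = (LEAST k. k \<in> A)"
  have "k \<in> A"
    unfolding k_def using False by (metis LeastI ex_in_conv)
  have "m \<in> A \<longleftrightarrow> k \<le> m" for m
    using up[OF \<open>k \<in> A\<close>] Least_le[of "\<lambda>k. k \<in> A" m] unfolding k_def by blast
  then have "A = {m. k \<le> m}"
    by blast
  then show ?thesis
    unfolding openin_S_D by blast
qed simp

text \<open>Open sets are upward closed, so they cut final segments, possibly empty, out of the
  chain. Conversely, the neighbourhood of \<open>f n\<close> from \<open>TD_space_nbhd\<close> omits
  all earlier terms and contains all later ones, so each final segment is open.\<close>

lemma ascending_chain_homeomorphic_S_D:
  assumes TD: "TD_space X" and less: "\<And>n. specialization_less X (f n) (f (Suc n))"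
  shows "range f \<subseteq> topspace X" "subtopology X (range f) homeomorphic_space S_D"
proof -
  have top: "f n \<in> topspace X" for n
    using less[of n] by (auto simp: specialization_less_def closure_of_singleton_iff)
  then show sub: "range f \<subseteq> topspace X"
    by blast
  have le: "f m \<in> X closure_of {f n}" if "m \<le> n" for m n
    using that
  proof (induction n rule: dec_induct)
    case base
    then show ?case
      using top by (simp add: closure_of_singleton_iff)
  next
    case (step n)
    then show ?case
      using less[of n] closure_of_singleton_trans unfolding specialization_less_def by metis
  qed
  \<comment> \<open>A repetition would put \<open>f (Suc m)\<close> below \<open>f m\<close> as well
    as above it.\<close>
  have neq: "f m \<noteq> f n" if "m < n" for m n
  proof
    assume "f m = f n"
    then have "f (Suc m) \<in> X closure_of {f m}"
      using le[of "Suc m" n] that by simp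
    then show False
      using less[of m] closure_of_singleton_antisym[OF TD] unfolding specialization_less_def by blast
  qed
  then have inj: "inj f"
    by (metis injI linorder_neqE_nat)
  have "openin (subtopology X (range f)) (f ` A) \<longleftrightarrow> openin (subtopology S_D (range id)) (id ` A)" for A
  proof
    assume "openin (subtopology X (range f)) (f ` A)"
    then obtain T where T: "openin X T" "f ` A = T \<inter> range f"
      by (auto simp: openin_subtopology)
    have "n \<in> A" if "m \<in> A" "m \<le> n" for m n
    proof -
      have "f m \<in> T"
        using T that by blast
      then have "f n \<in> f ` A"
        using le[OF that(2)] T by (auto simp: closure_of_singleton_iff)
      then show ?thesis
        using inj by (auto dest: injD)
    qed
    then show "openin (subtopology S_D (range id)) (id ` A)"
      using openin_S_D_if_upward[of A] by (simp add: subtopology_UNIV)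
  next
    assume "openin (subtopology S_D (range id)) (id ` A)"
    then have "A = {} \<or> (\<exists>n. A = {m. n \<le> m})"
      using openin_S_D[of A] by (simp add: subtopology_UNIV)
    then consider "A = {}" | n where "A = {m. n \<le> m}"
      by blast
    then show "openin (subtopology X (range f)) (f ` A)"
    proof cases
      case 2
      obtain U where U: "openin X U" "f n \<in> U" "U \<inter> X closure_of {f n} = {f n}"
        using TD_space_nbhd[OF TD top] by metis
      have "f m \<in> U \<longleftrightarrow> n \<le> m" for m
      proof
        assume "f m \<in> U"
        show "n \<le> m"
        proof (rule ccontr)
          assume "\<not> n \<le> m"
          then have "f m \<in> X closure_of {f n}" "f m \<noteq> f n"
            using le neq by auto
          then show False
            using U \<open>f m \<in> U\<close> by blast
        qed
      next
        assume "n \<le> m"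
        then show "f m \<in> U"
          using le[of n m] U by (auto simp: closure_of_singleton_iff)
      qed
      then have "f ` A = U \<inter> range f"
        using 2 by auto
      then show ?thesis
        using U(1) by (auto simp: openin_subtopology)
    qed simp
  qed
  then have "subtopology X (range f) homeomorphic_space subtopology S_D (range id)"
    by (intro homeomorphic_space_indexed inj sub) auto
  then show "subtopology X (range f) homeomorphic_space S_D"
    by (simp add: subtopology_UNIV)
qed

definition maximal_points :: "'a topology \<Rightarrow> 'a set" where
  "maximal_points X = {x \<in> topspace X. \<forall>y. \<not> specialization_less X x y}"

lemma t1_space_maximal_points: "t1_space (subtopology X (maximal_points X))"
  unfolding t1_space_def
proof (intro ballI impI)
  fix x y assume xy: "x \<in> topspace (subtopology X (maximal_points X))"
    "y \<in> topspace (subtopology X (maximal_points X))" "x \<noteq> y"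
  then have "x \<notin> X closure_of {y}" "x \<in> topspace X"
    unfolding maximal_points_def specialization_less_def by auto
  then obtain T where "openin X T" "x \<in> T" "y \<notin> T"
    by (auto simp: closure_of_singleton_iff)
  then have "openin (subtopology X (maximal_points X)) (T \<inter> maximal_points X)"
    "x \<in> T \<inter> maximal_points X" "y \<notin> T \<inter> maximal_points X"
    using xy by (auto simp: openin_subtopology)
  then show "\<exists>U. openin (subtopology X (maximal_points X)) U \<and> x \<in> U \<and> y \<notin> U"
    by blast
qed

text \<open>Without infinite ascending chains the converse order is well-founded, and a minimal
  element for it among the points above \<open>x\<close> is a maximal point.\<close>

lemma maximal_points_above:
  assumes TD: "TD_space X"
    and no_chain: "\<not> (\<exists>f. \<forall>n::nat. specialization_less X (f n) (f (Suc n)))"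
    and x: "x \<in> topspace X"
  obtains y where "y \<in> maximal_points X" "x \<in> X closure_of {y}"
proof -
  have "wf {(y, x). specialization_less X x y}"
    using no_chain unfolding wf_iff_no_infinite_down_chain by simp
  moreover have "x \<in> {y. x \<in> X closure_of {y}}"
    using x by (simp add: closure_of_singleton_iff)
  ultimately obtain y where y: "x \<in> X closure_of {y}"
    and min: "\<And>z. specialization_less X y z \<Longrightarrow> x \<notin> X closure_of {z}"
    by (rule wfE_min) auto
  have "y \<in> topspace X"
    using y x by (auto simp: closure_of_singleton_iff)
  moreover have "\<not> specialization_less X y z" for z
    using min[of z] y closure_of_singleton_trans[of x X y z] unfolding specialization_less_def by blast
  ultimately show ?thesis
    using that y unfolding maximal_points_def by blast
qed

text \<open>A non-empty finite open set of the T1 subspace would isolate some maximal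
  \<open>x\<close> there. The isolation then spreads to \<open>X\<close>, against
  perfectness.\<close>

lemma perfect_maximal_points:
  assumes TD: "TD_space X" and perf: "perfect_topology X"
    and no_chain: "\<not> (\<exists>f. \<forall>n::nat. specialization_less X (f n) (f (Suc n)))"
  shows "perfect_topology (subtopology X (maximal_points X))"
  unfolding perfect_topology_def
proof (intro allI impI notI)
  let ?M = "maximal_points X"
  fix A assume A: "openin (subtopology X ?M) A \<and> A \<noteq> {}" and fin: "finite A"
  then obtain x where x: "x \<in> A"
    by blast
  have "A \<subseteq> topspace (subtopology X ?M)"
    using A openin_subset by blast
  then have top: "A \<subseteq> ?M" "x \<in> topspace X"
    using x by auto
  have "closedin (subtopology X ?M) (A - {x})"
    using fin t1_space_closedin_finite[of "subtopology X ?M"] t1_space_maximal_points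
      \<open>A \<subseteq> topspace (subtopology X ?M)\<close> by (metis Diff_subset finite_Diff subset_trans)
  then have "openin (subtopology X ?M) (A - (A - {x}))"
    using A by (simp add: openin_diff)
  moreover have "A - (A - {x}) = {x}"
    using x by blast
  ultimately obtain U where U: "openin X U" "{x} = U \<inter> ?M"
    by (auto simp: openin_subtopology)
  obtain V where V: "openin X V" "x \<in> V" "V \<inter> X closure_of {x} = {x}"
    using TD_space_nbhd[OF TD top(2)] by metis
  \<comment> \<open>Each \<open>z\<close> in \<open>U\<close> has a maximal point above it, which
    again lies in \<open>U\<close> and so is \<open>x\<close>. Thus all of \<open>U\<close> lies
    below \<open>x\<close>, while \<open>V\<close> contains nothing strictly below
    \<open>x\<close>.\<close>
  have "U \<inter> V = {x}"
  proof -
    have "z = x" if "z \<in> U" "z \<in> V" for z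
    proof -
      have "z \<in> topspace X"
        using U(1) that openin_subset by blast
      then obtain y where y: "y \<in> ?M" "z \<in> X closure_of {y}"
        using maximal_points_above[OF TD no_chain] by metis
      then have "y \<in> U"
        using U(1) that(1) unfolding closure_of_singleton_iff by blast
      then have "y = x"
        using U(2) y(1) by blast
      then show ?thesis
        using V(3) y(2) that(2) by blast
    qed
    then show ?thesis
      using U V by blast
  qed
  then have "openin X {x}"
    using openin_Int[OF U(1) V(1)] by simp
  then show False
    using perf unfolding perfect_topology_def by blast
qed

section \<open>Subspaces with the cofinite topology\<close>

lemma second_countable_sequence:
  assumes "second_countable X" "topspace X \<noteq> {}"
  obtains C :: "nat \<Rightarrow> 'a set" where "\<And>n. openin X (C n)"
    "\<And>U x. openin X U \<Longrightarrow> x \<in> U \<Longrightarrow> \<exists>n. x \<in> C n \<and> C n \<subseteq> U"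
proof -
  obtain \<B> where B: "countable \<B>" "\<forall>V \<in> \<B>. openin X V"
    "\<forall>U x. openin X U \<and> x \<in> U \<longrightarrow> (\<exists>V \<in> \<B>. x \<in> V \<and> V \<subseteq> U)"
    using assms(1) unfolding second_countable_def by blast
  have "\<B> \<noteq> {}"
    using B(3) assms(2) openin_topspace by fastforce
  then have "range (from_nat_into \<B>) = \<B>"
    using B(1) by simp
  then show ?thesis
    using that[of "from_nat_into \<B>"] B(2,3) by (metis rangeE rangeI)
qed

text \<open>Density is tested on open \<open>V\<close> inside \<open>B\<close>, so the property
  passes to smaller open neighbourhoods. Its failure supplies disjoint open \<open>V\<close> and
  \<open>W\<close>, which is the branching step of the tree construction.\<close>

definition clinging :: "'a topology \<Rightarrow> 'a \<Rightarrow> 'a set \<Rightarrow> bool" where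
  "clinging X x B \<longleftrightarrow> openin X B \<and> x \<in> B \<and>
    (\<forall>V W. openin X V \<and> V \<noteq> {} \<and> V \<subseteq> B \<and> openin X W \<and> x \<in> W \<longrightarrow> V \<inter> W \<noteq> {})"

lemma clingingD:
  assumes "clinging X x B" "openin X V" "V \<noteq> {}" "V \<subseteq> B" "openin X W" "x \<in> W"
  shows "V \<inter> W \<noteq> {}"
  using assms by (simp add: clinging_def)

lemma clinging_shrink:
  "clinging X x B \<Longrightarrow> openin X V \<Longrightarrow> x \<in> V \<Longrightarrow> clinging X x (B \<inter> V)"
  unfolding clinging_def by auto

text \<open>The chosen points are such that a basic set \<open>C k\<close> containing one of them
  contains all points with index above \<open>k\<close>. Non-empty open traces are therefore
  cofinite, and T1 makes all cofinite traces open.\<close>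

lemma dense_clinging_imp_S_1:
  assumes sc: "second_countable X" and t1: "t1_space X" and perf: "perfect_topology X"
    and ne: "topspace X \<noteq> {}"
    and dense: "\<And>V. openin X V \<Longrightarrow> V \<noteq> {} \<Longrightarrow> \<exists>x \<in> V. \<exists>B. clinging X x B"
  obtains S where "S \<subseteq> topspace X" "subtopology X S homeomorphic_space S_1"
proof -
  obtain C where C: "\<And>n::nat. openin X (C n)"
    "\<And>U x. openin X U \<Longrightarrow> x \<in> U \<Longrightarrow> \<exists>n. x \<in> C n \<and> C n \<subseteq> U"
    using second_countable_sequence[OF sc ne] by metis
  have dense': "\<exists>x B. clinging X x B \<and> B \<subseteq> V" if "openin X V" "V \<noteq> {}" for V
    using dense[OF that] clinging_shrink[OF _ that(1)] by (metis inf_le2)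
  let ?P = "\<lambda>(n::nat) p. clinging X (fst p) (snd p)"
  \<comment> \<open>A state is a point with a set it clings to. Stage \<open>n\<close> drops the
    current point and settles \<open>C n\<close>: the next set goes inside \<open>C n\<close>
    whenever the current one meets it.\<close>
  let ?Q = "\<lambda>n p q. snd q \<subseteq> snd p - {fst p} \<and> (snd p \<inter> C n \<noteq> {} \<longrightarrow> snd q \<subseteq> C n)"
  have "\<exists>p. \<forall>n. ?P n (p n) \<and> ?Q n (p n) (p (Suc n))"
  proof (rule dependent_nat_choice)
    show "\<exists>p. ?P 0 p"
      using dense'[of "topspace X"] ne by auto
  next
    fix p n assume "?P n p"
    then have p: "openin X (snd p)" "fst p \<in> snd p"
      by (auto simp: clinging_def)
    define D where "D = (if snd p \<inter> C n = {} then snd p else snd p \<inter> C n)"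
    have D: "openin X D" "D \<noteq> {}" "D \<subseteq> snd p" "snd p \<inter> C n \<noteq> {} \<Longrightarrow> D \<subseteq> C n"
      using p C(1) by (auto simp: D_def)
    \<comment> \<open>Perfectness leaves something of \<open>D\<close> after the old point is
      dropped, and T1 keeps the rest open.\<close>
    have "infinite D"
      using perf D unfolding perfect_topology_def by blast
    then have "D - {fst p} \<noteq> {}"
      by (metis finite.simps finite_Diff2 infinite_remove)
    moreover have "openin X (D - {fst p})"
      using D(1) t1 p openin_subset[OF p(1)] closedin_t1_singleton[of X "fst p"]
      by (auto intro!: openin_diff)
    ultimately obtain x B where "clinging X x B" "B \<subseteq> D - {fst p}"
      using dense' by blast
    then show "\<exists>q. ?P (Suc n) q \<and> ?Q n p q"
      using D by (intro exI[of _ "(x, B)"]) auto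
  qed
  then obtain p where p: "\<forall>n. ?P n (p n) \<and> ?Q n (p n) (p (Suc n))" ..
  define x B where "x = (\<lambda>n. fst (p n))" and "B = (\<lambda>n. snd (p n))"
  have xB: "clinging X (x n) (B n)" "B (Suc n) \<subseteq> B n - {x n}"
    and BC: "B n \<inter> C n \<noteq> {} \<Longrightarrow> B (Suc n) \<subseteq> C n" for n
    using spec[OF p, of n] by (simp_all add: x_def B_def)
  have xin: "x n \<in> B n" and Bop: "openin X (B n)" for n
    using xB(1) by (auto simp: clinging_def)
  have mono: "B n \<subseteq> B m" if "m \<le> n" for m n
    by (rule lift_Suc_antimono_le[of B, OF _ that]) (use xB(2) in blast)
  have "x m \<noteq> x n" if "m < n" for m n
    using mono[of "Suc m" n] that xin[of n] xB(2)[of m] by auto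
  then have inj: "inj x"
    by (metis injI linorder_neqE_nat)
  have sub: "range x \<subseteq> topspace X"
    using xin Bop openin_subset by blast
  \<comment> \<open>It suffices that \<open>B k\<close> meets \<open>C k\<close>. For
    \<open>k \<le> m\<close> the point \<open>x m\<close> lies in both; otherwise \<open>B k\<close>
    is a non-empty open subset of \<open>B m\<close>, to which \<open>x m\<close> clings.\<close>
  have tail: "x n \<in> C k" if "x m \<in> C k" "k < n" for m n k
  proof -
    have "B k \<inter> C k \<noteq> {}"
    proof (cases "k \<le> m")
      case True
      then show ?thesis
        using mono xin that by blast
    next
      case False
      then have "B k \<subseteq> B m"
        using mono by simp
      moreover have "B k \<noteq> {}"
        using xin by blast
      ultimately show ?thesis
        using clingingD[OF xB(1)[of m] Bop _ _ C(1) that(1)] by simp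
    qed
    then show ?thesis
      using BC[of k] mono[of "Suc k" n] xin[of n] that(2) by auto
  qed
  have "openin (subtopology X (range x)) (x ` A) \<longleftrightarrow> openin (subtopology S_1 (range id)) (id ` A)" for A
  proof
    assume "openin (subtopology X (range x)) (x ` A)"
    then obtain T where T: "openin X T" "x ` A = T \<inter> range x"
      by (auto simp: openin_subtopology)
    have "finite (UNIV - A)" if "m \<in> A" for m
    proof -
      have "x m \<in> T"
        using T that by blast
      then obtain k where k: "x m \<in> C k" "C k \<subseteq> T"
        using C(2) T(1) by blast
      have "n \<in> A" if "k < n" for n
      proof -
        have "x n \<in> x ` A"
          using tail[OF k(1) that] k(2) T(2) by auto
        then show ?thesis
          using inj by (auto dest: injD)
      qed
      then have "UNIV - A \<subseteq> {..k}"
        by (auto simp: not_less[symmetric])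
      then show ?thesis
        using finite_subset by blast
    qed
    then show "openin (subtopology S_1 (range id)) (id ` A)"
      by (auto simp: subtopology_UNIV openin_S_1)
  next
    assume "openin (subtopology S_1 (range id)) (id ` A)"
    then have "A = {} \<or> finite (UNIV - A)"
      by (simp add: subtopology_UNIV openin_S_1)
    then consider "A = {}" | "finite (UNIV - A)"
      by blast
    then show "openin (subtopology X (range x)) (x ` A)"
    proof cases
      case 2
      then have "closedin X (x ` (UNIV - A))"
        using t1 sub by (intro t1_space_closedin_finite[THEN iffD1, rule_format]) auto
      moreover have "x ` A = (topspace X - x ` (UNIV - A)) \<inter> range x"
        using inj sub by (auto dest: injD)
      ultimately show ?thesis
        unfolding openin_subtopology by blast
    qed simp
  qed
  then have "subtopology X (range x) homeomorphic_space subtopology S_1 (range id)"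
    by (intro homeomorphic_space_indexed inj sub) auto
  then show ?thesis
    using that sub by (simp add: subtopology_UNIV)
qed

section \<open>Tree schemes and copies of the rationals\<close>

text \<open>The children of the node s are the lists n # s, so the nodes at or below s are the lists t @ s.\<close>

definition splits_at :: "'a topology \<Rightarrow> 'a \<times> 'a set \<Rightarrow> (nat \<Rightarrow> 'a \<times> 'a set) \<Rightarrow> bool" where
  "splits_at X p c \<longleftrightarrow>
    (\<forall>n. snd (c n) \<subseteq> snd p) \<and>
    (\<forall>m n. m \<noteq> n \<longrightarrow> snd (c m) \<inter> snd (c n) = {}) \<and>
    (\<forall>n. \<exists>W. openin X W \<and> fst p \<in> W \<and> W \<inter> snd (c n) = {}) \<and>
    (\<forall>U. openin X U \<and> fst p \<in> U \<longrightarrow> (\<exists>N. \<forall>n\<ge>N. snd (c n) \<subseteq> U))"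

text \<open>The sets are a frame for the points, whose subspace is the object of interest. Around
  each node's point, any finitely many child subtrees can be avoided, and every neighbourhood
  absorbs almost all of them.\<close>

definition tree_scheme :: "'a topology \<Rightarrow> (nat list \<Rightarrow> 'a \<times> 'a set) \<Rightarrow> bool" where
  "tree_scheme X F \<longleftrightarrow> (\<forall>s. openin X (snd (F s)) \<and> fst (F s) \<in> snd (F s) \<and>
    splits_at X (F s) (\<lambda>n. F (n # s)))"

text \<open>Dependent choice along a tree. All children of a node are chosen at once, because
  \<open>R\<close> relates the siblings to each other.\<close>

lemma tree_choice:
  assumes "Q a" "\<And>a. Q a \<Longrightarrow> \<exists>c::nat \<Rightarrow> 'b. (\<forall>n. Q (c n)) \<and> R a c"
  shows "\<exists>F :: nat list \<Rightarrow> 'b. F [] = a \<and> (\<forall>s. Q (F s) \<and> R (F s) (\<lambda>n. F (n # s)))"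
proof -
  obtain ch where ch: "\<And>a. Q a \<Longrightarrow> (\<forall>n. Q (ch a n)) \<and> R a (ch a)"
    using assms(2) by metis
  define F where "F = rec_list a (\<lambda>n _ p. ch p n)"
  have F: "F [] = a" "\<And>n s. F (n # s) = ch (F s) n"
    by (simp_all add: F_def)
  have Q: "Q (F s)" for s
    by (induction s) (use assms(1) ch in \<open>auto simp: F\<close>)
  show ?thesis
    using F Q ch by (intro exI[of _ F]) simp
qed

context
  fixes X :: "'a topology" and F :: "nat list \<Rightarrow> 'a \<times> 'a set"
  assumes F: "tree_scheme X F"
begin

lemma tree_scheme_point: "openin X (snd (F s))" "fst (F s) \<in> snd (F s)"
  and tree_scheme_disjoint: "m \<noteq> n \<Longrightarrow> snd (F (m # s)) \<inter> snd (F (n # s)) = {}"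
  and tree_scheme_separated: "\<exists>W. openin X W \<and> fst (F s) \<in> W \<and> W \<inter> snd (F (n # s)) = {}"
  and tree_scheme_tendsto: "openin X U \<Longrightarrow> fst (F s) \<in> U \<Longrightarrow> \<exists>N. \<forall>n\<ge>N. snd (F (n # s)) \<subseteq> U"
  using F unfolding tree_scheme_def splits_at_def by (auto 0 3)

lemma tree_scheme_mono: "snd (F (t @ s)) \<subseteq> snd (F s)"
proof (induction t)
  case (Cons n t)
  then show ?case
    using F unfolding tree_scheme_def splits_at_def by fastforce
qed simp

lemma tree_scheme_point_notin_child: "fst (F s) \<notin> snd (F (n # s))"
  using tree_scheme_separated[of s n] by blast

text \<open>The sets thus determine the tree order: among the points of the scheme, the set of a
  node captures only those at or below it.\<close>

lemma tree_scheme_descendant: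
  "fst (F u) \<in> snd (F s) \<Longrightarrow> \<exists>t. u = t @ s"
proof (induction s)
  case (Cons n s)
  have "fst (F u) \<in> snd (F s)"
    using Cons.prems tree_scheme_mono[of "[n]" s] by auto
  then obtain t where t: "u = t @ s"
    using Cons.IH by blast
  show ?case
  \<comment> \<open>Lists grow at the head, so the last entry of \<open>t\<close> names the child of
    \<open>s\<close> on the way to \<open>u\<close>.\<close>
  proof (cases t rule: rev_cases)
    case Nil
    then show ?thesis
      using t Cons.prems tree_scheme_point_notin_child by simp
  next
    case (snoc t' m)
    have "fst (F u) \<in> snd (F (m # s))"
      using tree_scheme_point(2)[of u] tree_scheme_mono[of t' "m # s"] t snoc by auto
    then have "m = n"
      using tree_scheme_disjoint[of m n s] Cons.prems by blast
    then show ?thesis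
      using t snoc by simp
  qed
qed simp

lemma tree_scheme_inj: "inj (\<lambda>s. fst (F s))"
proof (rule injI)
  fix s u assume eq: "fst (F s) = fst (F u)"
  have "\<exists>t. u = t @ s" "\<exists>t. s = t @ u"
    using tree_scheme_descendant[of u s] tree_scheme_descendant[of s u] tree_scheme_point(2) eq
    by metis+
  then show "s = u"
    by auto
qed

lemma tree_scheme_range: "range (\<lambda>s. fst (F s)) \<subseteq> topspace X"
  using tree_scheme_point openin_subset by blast

text \<open>The right-hand side does not mention X, so all tree schemes span homeomorphic subspaces.\<close>

lemma tree_scheme_openin_iff:
  "openin (subtopology X (range (\<lambda>s. fst (F s)))) ((\<lambda>s. fst (F s)) ` A) \<longleftrightarrow>
    (\<forall>s \<in> A. \<exists>N. \<forall>n\<ge>N. \<forall>t. t @ n # s \<in> A)"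
proof
  let ?x = "\<lambda>s. fst (F s)"
  assume "openin (subtopology X (range ?x)) (?x ` A)"
  then obtain T where T: "openin X T" "?x ` A = T \<inter> range ?x"
    by (auto simp: openin_subtopology)
  show "\<forall>s \<in> A. \<exists>N. \<forall>n\<ge>N. \<forall>t. t @ n # s \<in> A"
  proof
    fix s assume "s \<in> A"
    then have "?x s \<in> T"
      using T by blast
    then obtain N where N: "\<forall>n\<ge>N. snd (F (n # s)) \<subseteq> T"
      using tree_scheme_tendsto T(1) by blast
    have "t @ n # s \<in> A" if "n \<ge> N" for n t
    proof -
      have "?x (t @ n # s) \<in> T"
        using N that tree_scheme_mono[of t "n # s"] tree_scheme_point(2)[of "t @ n # s"] by blast
      then have "?x (t @ n # s) \<in> ?x ` A"
        using T(2) by blast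
      then show ?thesis
        using tree_scheme_inj by (auto dest: injD)
    qed
    then show "\<exists>N. \<forall>n\<ge>N. \<forall>t. t @ n # s \<in> A"
      by blast
  qed
next
  let ?x = "\<lambda>s. fst (F s)"
  assume A: "\<forall>s \<in> A. \<exists>N. \<forall>n\<ge>N. \<forall>t. t @ n # s \<in> A"
  have "\<exists>T. openin (subtopology X (range ?x)) T \<and> ?x s \<in> T \<and> T \<subseteq> ?x ` A" if s: "s \<in> A" for s
  proof -
    obtain N where N: "\<forall>n\<ge>N. \<forall>t. t @ n # s \<in> A"
      using A s by blast
    obtain W where W: "\<And>n. openin X (W n)" "\<And>n. ?x s \<in> W n" "\<And>n. W n \<inter> snd (F (n # s)) = {}"
      using tree_scheme_separated[of s] by metis
    \<comment> \<open>The sets \<open>W n\<close> cut away the first \<open>N\<close> child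
      subtrees, the only ones that may leave \<open>A\<close>. Inserting \<open>topspace X\<close>
      covers \<open>N = 0\<close>, where the family of the \<open>W n\<close> is empty.\<close>
    define T where "T = snd (F s) \<inter> \<Inter> (insert (topspace X) (W ` {..<N}))"
    have "openin X T"
      unfolding T_def using W(1) tree_scheme_point by (intro openin_Int openin_Inter) auto
    moreover have "?x s \<in> T"
      using W(2) tree_scheme_point[of s] openin_subset unfolding T_def by blast
    moreover have "T \<inter> range ?x \<subseteq> ?x ` A"
    proof
      fix y assume "y \<in> T \<inter> range ?x"
      then obtain u where u: "y = ?x u" "?x u \<in> T"
        by blast
      then have "?x u \<in> snd (F s)"
        by (simp add: T_def)
      then obtain t where t: "u = t @ s"
        using tree_scheme_descendant by blast
      show "y \<in> ?x ` A"
      proof (cases t rule: rev_cases)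
        case Nil
        then show ?thesis
          using t s u by simp
      next
        case (snoc t' m)
        have "?x u \<in> snd (F (m # s))"
          using tree_scheme_point(2)[of u] tree_scheme_mono[of t' "m # s"] t snoc by auto
        then have "m \<ge> N"
          using u(2) W(3)[of m] by (fastforce simp: T_def)
        then show ?thesis
          using N t snoc u by auto
      qed
    qed
    ultimately show ?thesis
      by (intro exI[of _ "T \<inter> range ?x"]) (auto simp: openin_subtopology)
  qed
  then show "openin (subtopology X (range ?x)) (?x ` A)"
    by (subst openin_subopen) blast
qed

end

lemma tree_schemes_homeomorphic:
  assumes "tree_scheme X F" "tree_scheme Y G"
  shows "subtopology X (range (\<lambda>s. fst (F s))) homeomorphic_space subtopology Y (range (\<lambda>s. fst (G s)))"
  using assms
  by (intro homeomorphic_space_indexed)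
    (simp_all add: tree_scheme_inj tree_scheme_range tree_scheme_openin_iff)

text \<open>At a node with point \<open>x\<close>, failure of clinging splits a neighbourhood of
  \<open>x\<close> into an open set for the next child and a disjoint smaller neighbourhood of
  \<open>x\<close>. Shrinking into \<open>C n\<close> whenever \<open>x \<in> C n\<close> makes the
  children converge to \<open>x\<close>.\<close>

lemma no_clinging_imp_tree_scheme:
  assumes sc: "second_countable X" and V0: "openin X V0" "V0 \<noteq> {}"
    and no_cling: "\<And>x B. x \<in> V0 \<Longrightarrow> \<not> clinging X x B"
  obtains F where "tree_scheme X F"
proof -
  have "topspace X \<noteq> {}"
    using V0 openin_subset by blast
  then obtain C where C: "\<And>n::nat. openin X (C n)"
    "\<And>U x. openin X U \<Longrightarrow> x \<in> U \<Longrightarrow> \<exists>n. x \<in> C n \<and> C n \<subseteq> U"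
    using second_countable_sequence[OF sc] by metis
  let ?Q = "\<lambda>p. openin X (snd p) \<and> fst p \<in> snd p \<and> snd p \<subseteq> V0"
  have step: "\<exists>c. (\<forall>n. ?Q (c n)) \<and> splits_at X a c" if a: "?Q a" for a
  proof -
    obtain x V where xV: "a = (x, V)" "openin X V" "x \<in> V" "V \<subseteq> V0"
      using a by (cases a) auto
    let ?P = "\<lambda>(n::nat) q. openin X (snd q) \<and> x \<in> snd q \<and> snd q \<subseteq> V"
    let ?R = "\<lambda>n q r. openin X (fst r) \<and> fst r \<noteq> {} \<and> fst r \<subseteq> snd q \<and>
      snd r \<subseteq> snd q \<and> fst r \<inter> snd r = {} \<and> (x \<in> C n \<longrightarrow> fst r \<subseteq> C n \<and> snd r \<subseteq> C n)"
    have "\<exists>q. \<forall>n. ?P n (q n) \<and> ?R n (q n) (q (Suc n))"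
    proof (rule dependent_nat_choice)
      show "\<exists>q. ?P 0 q"
        using xV by auto
    next
      fix q n assume q: "?P n q"
      define D where "D = (if x \<in> C n then snd q \<inter> C n else snd q)"
      have D: "openin X D" "x \<in> D" "D \<subseteq> snd q" "x \<in> C n \<Longrightarrow> D \<subseteq> C n"
        using q C(1) by (auto simp: D_def)
      have "\<not> clinging X x D"
        using no_cling xV by blast
      then obtain V' W' where V': "openin X V'" "V' \<noteq> {}" "V' \<subseteq> D"
        and W': "openin X W'" "x \<in> W'" "V' \<inter> W' = {}"
        using D(1,2) unfolding clinging_def by metis
      have "openin X (W' \<inter> D)" "x \<in> W' \<inter> D" "V' \<inter> (W' \<inter> D) = {}"
        using D W' by auto
      moreover have "V' \<subseteq> snd q" "W' \<inter> D \<subseteq> snd q" "W' \<inter> D \<subseteq> V"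
        using V'(3) D(3) q by blast+
      moreover have "x \<in> C n \<Longrightarrow> V' \<subseteq> C n \<and> W' \<inter> D \<subseteq> C n"
        using V'(3) D(4) by blast
      ultimately show "\<exists>r. ?P (Suc n) r \<and> ?R n q r"
        using V'(1,2) by (intro exI[of _ "(V', W' \<inter> D)"]) simp
    qed
    then obtain q where q: "\<forall>n. ?P n (q n) \<and> ?R n (q n) (q (Suc n))" ..
    \<comment> \<open>The first component of \<open>q 0\<close> is unconstrained, so the sets split
      off start with \<open>q (Suc 0)\<close>.\<close>
    define W U where "W = (\<lambda>n. snd (q n))" and "U = (\<lambda>n. fst (q (Suc n)))"
    have W: "openin X (W n)" "x \<in> W n" "W n \<subseteq> V" "W (Suc n) \<subseteq> W n"
      and U: "openin X (U n)" "U n \<noteq> {}" "U n \<subseteq> W n" "U n \<inter> W (Suc n) = {}"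
      and WC: "x \<in> C n \<Longrightarrow> U n \<subseteq> C n" "x \<in> C n \<Longrightarrow> W (Suc n) \<subseteq> C n" for n
      using spec[OF q, of n] by (simp_all add: W_def U_def)
    have mono: "W n \<subseteq> W m" if "m \<le> n" for m n
      by (rule lift_Suc_antimono_le[of W, OF _ that]) (rule W(4))
    have disj: "U m \<inter> U n = {}" if "m < n" for m n
      using mono[of "Suc m" n] that U(3)[of n] U(4)[of m] by auto
    define y where "y = (\<lambda>n. SOME z. z \<in> U n)"
    have y: "y n \<in> U n" for n
      using U(2) by (simp add: y_def some_in_eq)
    define c where "c = (\<lambda>n. (y n, U n))"
    have "?Q (c n)" for n
      using U W y xV by (fastforce simp: c_def)
    moreover have "splits_at X a c"
      unfolding splits_at_def
    proof (intro conjI allI impI)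
      show "snd (c n) \<subseteq> snd a" for n
        using U(3) W(3) xV by (fastforce simp: c_def)
      show "snd (c m) \<inter> snd (c n) = {}" if "m \<noteq> n" for m n
        using disj[of m n] disj[of n m] that by (cases m n rule: linorder_cases) (auto simp: c_def)
      show "\<exists>W. openin X W \<and> fst a \<in> W \<and> W \<inter> snd (c n) = {}" for n
        using W[of "Suc n"] U(4)[of n] xV by (intro exI[of _ "W (Suc n)"]) (auto simp: c_def)
      fix T assume "openin X T \<and> fst a \<in> T"
      then obtain k where k: "x \<in> C k" "C k \<subseteq> T"
        using C(2) xV by (metis fst_conv)
      have "U n \<subseteq> T" if "n \<ge> k" for n
        using WC[OF k(1)] k(2) U(3)[of n] mono[of "Suc k" n] that
        by (cases "n = k") (auto simp: Suc_le_eq)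
      then show "\<exists>N. \<forall>n\<ge>N. snd (c n) \<subseteq> T"
        by (auto simp: c_def)
    qed
    ultimately show ?thesis
      by blast
  qed
  obtain x0 where "x0 \<in> V0"
    using V0 by blast
  then have "?Q (x0, V0)"
    using V0 by simp
  from tree_choice[of ?Q _ "splits_at X", OF this step]
  obtain F where "\<forall>s. ?Q (F s) \<and> splits_at X (F s) (\<lambda>n. F (n # s))"
    by blast
  then show ?thesis
    using that[of F] unfolding tree_scheme_def by blast
qed

section \<open>Exhausting the rationals by a tree scheme\<close>

lemma rational_in_shell:
  fixes x r r' :: real
  assumes "x \<in> \<rat>" "0 \<le> r'" "r' < r"
  obtains q where "q \<in> \<rat>" "r' < dist x q" "dist x q < r"
proof -
  obtain q where "q \<in> \<rat>" "x + r' < q" "q < x + r"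
    using Rats_dense_in_real[of "x + r'" "x + r"] assms by auto
  then show ?thesis
    using that[of q] assms by (auto simp: dist_real_def)
qed

text \<open>Concentric shells around \<open>x\<close> with irrational radii are open in the
  rationals and miss no rational but \<open>x\<close>. Only the sets of the children are fixed here;
  \<open>c\<close> is left general so that their points can be chosen afterwards.\<close>

lemma rationals_split:
  fixes x :: real
  assumes x: "x \<in> \<rat>" and V: "openin S_2 V" "x \<in> V"
  shows "\<exists>U :: nat \<Rightarrow> real set. (\<forall>n. openin S_2 (U n) \<and> U n \<noteq> {}) \<and> (\<Union>n. U n) = V - {x} \<and>
    (\<forall>c. (\<forall>n. snd (c n) = U n) \<longrightarrow> splits_at S_2 (x, V) c)"
proof -
  obtain T where T: "open T" "V = T \<inter> \<rat>"
    using V(1) by (auto simp: S_2_def openin_subtopology)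
  then obtain e where e: "0 < e" "ball x e \<subseteq> T"
    using V(2) openE by blast
  have "\<not> {0<..<1::real} \<subseteq> \<rat>"
    using uncountable_open_interval[of 0 "1::real"] countable_rat countable_subset by auto
  \<comment> \<open>Rational multiples of one irrational number serve as radii; the bound on
    \<open>d\<close> keeps them all below \<open>e\<close>.\<close>
  then obtain \<theta> :: real where \<theta>: "0 < \<theta>" "\<theta> \<notin> \<rat>"
    by (auto simp: subset_iff)
  obtain d where d: "d \<in> \<rat>" "0 < d" "d < e / \<theta>"
    using Rats_dense_in_real[of 0 "e / \<theta>"] e(1) \<theta>(1) by auto
  define r where "r = (\<lambda>n. \<theta> * d / real (Suc n))"
  have r_pos: "0 < r n" for n
    using d \<theta> by (simp add: r_def)
  have r_less: "r n < r m" if "m < n" for m n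
    using d \<theta> that by (auto simp: r_def intro!: divide_strict_left_mono)
  have r0: "r 0 < e"
    using d(3) \<theta> by (simp add: r_def field_simps)
  have r_irr: "r n \<notin> \<rat>" for n
  proof
    assume "r n \<in> \<rat>"
    then have "r n * real (Suc n) / d \<in> \<rat>"
      using d(1) by (intro Rats_divide Rats_mult) auto
    moreover have "r n * real (Suc n) / d = \<theta>"
      using d(2) by (simp add: r_def)
    ultimately show False
      using \<theta>(2) by simp
  qed
  have r_lim: "r \<longlonglongrightarrow> 0"
  proof -
    have "(\<lambda>n. \<theta> * d * (1 / real (Suc n))) \<longlonglongrightarrow> \<theta> * d * 0"
      using LIMSEQ_Suc[OF lim_1_over_n[where 'a=real]] by (intro tendsto_mult_left) simp
    then show ?thesis
      by (simp add: r_def)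
  qed
  \<comment> \<open>Shell 0 has no outer bound, so it takes up all of \<open>V\<close> beyond
    \<open>r 0\<close>.\<close>
  define U where "U = (\<lambda>n. {q \<in> V. r (Suc n) < dist x q \<and> (n = 0 \<or> dist x q < r n)})"
  have opn: "openin S_2 (U n)" for n
  proof -
    have "U n = (T \<inter> (- cball x (r (Suc n))) \<inter> (if n = 0 then UNIV else ball x (r n))) \<inter> \<rat>"
      using T by (auto simp: U_def)
    moreover have "open (T \<inter> (- cball x (r (Suc n))) \<inter> (if n = 0 then UNIV else ball x (r n)))"
      using T by (auto intro!: open_Int)
    ultimately show ?thesis
      unfolding S_2_def openin_subtopology by auto
  qed
  have ne: "U n \<noteq> {}" for n
  proof -
    obtain q where q: "q \<in> \<rat>" "r (Suc n) < dist x q" "dist x q < r n"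
      using rational_in_shell[OF x] r_pos[of "Suc n"] r_less[of n "Suc n"]
      by (metis lessI less_imp_le)
    have "r n < e"
      using r_less[of 0 n] r0 by (cases n) auto
    then have "q \<in> V"
      using q e(2) T by (auto simp: subset_iff)
    then show ?thesis
      using q by (auto simp: U_def)
  qed
  have un: "(\<Union>n. U n) = V - {x}"
  proof
    show "(\<Union>n. U n) \<subseteq> V - {x}"
    proof
      fix q assume "q \<in> (\<Union>n. U n)"
      then obtain n where "q \<in> V" "r (Suc n) < dist x q"
        by (auto simp: U_def)
      then show "q \<in> V - {x}"
        using r_pos[of "Suc n"] by auto
    qed
    show "V - {x} \<subseteq> (\<Union>n. U n)"
    proof
      fix q assume q: "q \<in> V - {x}"
      then have "0 < dist x q"
        by simp
      then have "\<exists>N. r (Suc N) < dist x q"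
        using order_tendstoD(2)[OF LIMSEQ_Suc[OF r_lim]] unfolding eventually_sequentially by blast
      \<comment> \<open>Minimality gives \<open>dist x q \<le> r n\<close> for positive
        \<open>n\<close>; equality is impossible since the distance is rational and
        \<open>r n\<close> is not.\<close>
      define n where "n = (LEAST N. r (Suc N) < dist x q)"
      have n: "r (Suc n) < dist x q"
        unfolding n_def using \<open>\<exists>N. r (Suc N) < dist x q\<close> by (rule LeastI_ex)
      have "dist x q < r n" if "n \<noteq> 0"
      proof -
        have "\<not> r (Suc (n - 1)) < dist x q"
          using not_less_Least[of "n - 1" "\<lambda>N. r (Suc N) < dist x q"] that by (simp add: n_def)
        moreover have "dist x q \<in> \<rat>"
          using q x T by (auto simp: dist_real_def)
        ultimately show ?thesis
          using r_irr[of n] that by (metis Suc_pred' bot_nat_0.not_eq_extremum linorder_neqE_linordered_idom)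
      qed
      then show "q \<in> (\<Union>n. U n)"
        using q n by (auto simp: U_def)
    qed
  qed
  have disj: "U m \<inter> U n = {}" if "m < n" for m n
  proof -
    have "r n \<le> r (Suc m)"
      using that r_less[of "Suc m" n] by (cases "n = Suc m") auto
    then show ?thesis
      using that by (auto simp: U_def)
  qed
  have "splits_at S_2 (x, V) c" if c: "\<And>n. snd (c n) = U n" for c
    unfolding splits_at_def c fst_conv snd_conv
  proof (intro conjI allI impI)
    show "U n \<subseteq> V" for n
      by (auto simp: U_def)
    show "U m \<inter> U n = {}" if "m \<noteq> n" for m n
      using disj[of m n] disj[of n m] that by (cases m n rule: linorder_cases) auto
    show "\<exists>W. openin S_2 W \<and> x \<in> W \<and> W \<inter> U n = {}" for n
      using x r_pos[of "Suc n"] unfolding S_2_def openin_subtopology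
      by (intro exI[of _ "ball x (r (Suc n)) \<inter> \<rat>"]) (auto simp: U_def)
    fix A assume A: "openin S_2 A \<and> x \<in> A"
    then obtain T' where T': "open T'" "A = T' \<inter> \<rat>"
      by (auto simp: S_2_def openin_subtopology)
    then obtain d' where d': "0 < d'" "ball x d' \<subseteq> T'"
      using A openE by blast
    obtain N where N: "\<And>n. n \<ge> N \<Longrightarrow> r n < d'"
      using order_tendstoD(2)[OF r_lim d'(1)] by (auto simp: eventually_sequentially)
    have "U n \<subseteq> A" if "n \<ge> Suc N" for n
      using N[of n] that d'(2) T' T by (auto simp: U_def subset_iff)
    then show "\<exists>N. \<forall>n\<ge>N. U n \<subseteq> A"
      by blast
  qed
  then show ?thesis
    using opn ne un by (intro exI[of _ U]) blast
qed

text \<open>Always picking the point of least index makes the scheme exhaust the rationals.\<close>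

lemma tree_scheme_rationals:
  obtains G where "tree_scheme S_2 G" "range (\<lambda>s. fst (G s)) = \<rat>"
proof -
  let ?i = "to_nat_on (\<rat> :: real set)"
  have inj: "inj_on ?i \<rat>"
    using countable_rat by (rule inj_on_to_nat_on)
  let ?Q = "\<lambda>p. openin S_2 (snd p) \<and> snd p \<subseteq> \<rat> \<and> fst p \<in> snd p \<and> (\<forall>q \<in> snd p. ?i (fst p) \<le> ?i q)"
  let ?R = "\<lambda>p c. splits_at S_2 p c \<and> (\<Union>n. snd (c n)) = snd p - {fst p}"
  have least: "\<exists>p. ?Q p \<and> snd p = V" if V: "openin S_2 V" "V \<noteq> {}" for V
  proof -
    obtain x where "x \<in> V" "\<forall>q \<in> V. ?i x \<le> ?i q"
      using V(2) ex_has_least_nat[of "\<lambda>x. x \<in> V" _ ?i] by blast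
    moreover have "V \<subseteq> \<rat>"
      using openin_subset[OF V(1)] by (simp add: S_2_def)
    ultimately show ?thesis
      using V(1) by (intro exI[of _ "(x, V)"]) simp
  qed
  have step: "\<exists>c. (\<forall>n. ?Q (c n)) \<and> ?R a c" if a: "?Q a" for a
  proof -
    obtain x V where xV: "a = (x, V)"
      by (cases a)
    then have "x \<in> \<rat>" "openin S_2 V" "x \<in> V"
      using a by auto
    from rationals_split[OF this]
    obtain U :: "nat \<Rightarrow> real set" where U: "\<forall>n. openin S_2 (U n) \<and> U n \<noteq> {}"
      "(\<Union>n. U n) = V - {x}" "\<forall>c. (\<forall>n. snd (c n) = U n) \<longrightarrow> splits_at S_2 (x, V) c"
      by (elim exE conjE)
    have "\<forall>n. \<exists>p. ?Q p \<and> snd p = U n"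
      using U(1) by (intro allI least) simp_all
    from choice[OF this] obtain c where c: "\<forall>n. ?Q (c n) \<and> snd (c n) = U n" ..
    then have "?R a c"
      using U(2) spec[OF U(3), of c] xV by simp
    then show ?thesis
      using c by blast
  qed
  have "openin S_2 \<rat>"
    by (metis S_2_def openin_topspace topspace_euclidean_subtopology)
  then obtain a where a: "?Q a" "snd a = \<rat>"
    using least[of \<rat>] Rats_0 by (metis empty_iff)
  have "\<exists>G. G [] = a \<and> (\<forall>s. ?Q (G s) \<and> ?R (G s) (\<lambda>n. G (n # s)))"
  proof (rule tree_choice[of ?Q a ?R])
    show "\<exists>c. (\<forall>n. ?Q (c n)) \<and> ?R b c" if "?Q b" for b
      using that by (rule step)
  qed (rule a(1))
  then obtain G where "G [] = a \<and> (\<forall>s. ?Q (G s) \<and> ?R (G s) (\<lambda>n. G (n # s)))" ..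
  then have G: "G [] = a" "?Q (G s)" "?R (G s) (\<lambda>n. G (n # s))" for s
    by simp_all
  have "\<exists>s. fst (G s) = q" if q: "q \<in> \<rat>" for q
  proof (rule ccontr)
    assume no: "\<nexists>s. fst (G s) = q"
    \<comment> \<open>A missed \<open>q\<close> would stay in the sets along an infinite branch. The
      indices of the points on it increase strictly, yet by leastness none exceeds the index of
      \<open>q\<close>.\<close>
    have "\<exists>s. q \<in> snd (G s) \<and> n \<le> ?i (fst (G s))" for n
    proof (induction n)
      case 0
      then show ?case
        using G(1) a(2) q by (intro exI[of _ "[]"]) simp
    next
      case (Suc n)
      then obtain s where s: "q \<in> snd (G s)" "n \<le> ?i (fst (G s))"
        by blast
      then have "q \<in> (\<Union>m. snd (G (m # s)))"
        using no G(3)[of s] by auto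
      then obtain m where m: "q \<in> snd (G (m # s))"
        by blast
      have child: "fst (G (m # s)) \<in> snd (G s) - {fst (G s)}"
        using G(2)[of "m # s"] G(3)[of s] by blast
      then have "?i (fst (G s)) \<le> ?i (fst (G (m # s)))"
        using G(2)[of s] by blast
      moreover have "?i (fst (G s)) \<noteq> ?i (fst (G (m # s)))"
        using inj_onD[OF inj] child G(2)[of s] by (metis DiffD1 DiffD2 singletonI subsetD)
      ultimately show ?case
        using s(2) m by (intro exI[of _ "m # s"]) simp
    qed
    then obtain s where "q \<in> snd (G s)" "Suc (?i q) \<le> ?i (fst (G s))"
      by blast
    then show False
      using G(2)[of s] by fastforce
  qed
  moreover have "fst (G s) \<in> \<rat>" for s
    using G(2)[of s] by blast
  ultimately have "range (\<lambda>s. fst (G s)) = \<rat>"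
    by (auto simp: image_iff)
  moreover have "tree_scheme S_2 G"
    unfolding tree_scheme_def using G by blast
  ultimately show ?thesis
    using that by blast
qed

lemma tree_scheme_homeomorphic_S_2:
  assumes "tree_scheme X F"
  shows "subtopology X (range (\<lambda>s. fst (F s))) homeomorphic_space S_2"
proof -
  obtain G where G: "tree_scheme S_2 G" "range (\<lambda>s. fst (G s)) = \<rat>"
    using tree_scheme_rationals by blast
  have "subtopology S_2 \<rat> = S_2"
    by (simp add: S_2_def subtopology_subtopology)
  then show ?thesis
    using tree_schemes_homeomorphic[OF assms G(1)] G(2) by simp
qed

section \<open>The trichotomy\<close>

lemma t1_perfect_contains_S_1_or_S_2:
  assumes "second_countable X" "t1_space X" "perfect_topology X" "topspace X \<noteq> {}"
  obtains S where "S \<subseteq> topspace X"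
    "subtopology X S homeomorphic_space S_1 \<or> subtopology X S homeomorphic_space S_2"
proof (cases "\<forall>V. openin X V \<and> V \<noteq> {} \<longrightarrow> (\<exists>x \<in> V. \<exists>B. clinging X x B)")
  case True
  then show ?thesis
    using dense_clinging_imp_S_1[OF assms] that by metis
next
  case False
  then obtain V where "openin X V" "V \<noteq> {}" "\<And>x B. x \<in> V \<Longrightarrow> \<not> clinging X x B"
    by blast
  then obtain F where "tree_scheme X F"
    using no_clinging_imp_tree_scheme[OF assms(1)] by metis
  then show ?thesis
    using that tree_scheme_range tree_scheme_homeomorphic_S_2 by metis
qed

theorem theorem3p5:
  fixes X :: "'a topology"
  assumes "topspace X \<noteq> {}"
    and "second_countable X"
    and "perfect_topology X"
    and "TD_space X"
    and "countable (topspace X)"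
  shows "\<exists>S \<in> Delta02 X. perfect_topology (subtopology X S) \<and>
    (subtopology X S homeomorphic_space S_D \<or>
     subtopology X S homeomorphic_space S_1 \<or>
     subtopology X S homeomorphic_space S_2)"
proof -
  have "\<exists>S. S \<subseteq> topspace X \<and> (subtopology X S homeomorphic_space S_D \<or>
    subtopology X S homeomorphic_space S_1 \<or> subtopology X S homeomorphic_space S_2)"
  proof (cases "\<exists>f. \<forall>n::nat. specialization_less X (f n) (f (Suc n))")
    case True
    then show ?thesis
      using ascending_chain_homeomorphic_S_D[OF assms(4)] by metis
  next
    case False
    let ?Y = "subtopology X (maximal_points X)"
    have "maximal_points X \<noteq> {}"
      using maximal_points_above[OF assms(4) False] assms(1) by (metis ex_in_conv)
    moreover have "maximal_points X \<subseteq> topspace X"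
      by (auto simp: maximal_points_def)
    ultimately have top: "topspace ?Y = maximal_points X" "topspace ?Y \<noteq> {}"
      by (auto simp: Int_absorb1)
    obtain S where S: "S \<subseteq> topspace ?Y"
      "subtopology ?Y S homeomorphic_space S_1 \<or> subtopology ?Y S homeomorphic_space S_2"
      using t1_perfect_contains_S_1_or_S_2[OF second_countable_subtopology[OF assms(2)]
          t1_space_maximal_points perfect_maximal_points[OF assms(4,3) False] top(2)]
      by blast
    have "subtopology ?Y S = subtopology X S"
      using S(1) top(1) by (simp add: subtopology_subtopology Int_absorb1)
    then show ?thesis
      using S top(1) \<open>maximal_points X \<subseteq> topspace X\<close> by auto
  qed
  then obtain S where S: "S \<subseteq> topspace X" and homeo: "subtopology X S homeomorphic_space S_D \<or>
    subtopology X S homeomorphic_space S_1 \<or> subtopology X S homeomorphic_space S_2"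
    by blast
  \<comment> \<open>Perfectness is carried over from the model space, whichever of the three it
    is.\<close>
  have "perfect_topology (subtopology X S)"
    using homeo perfect_topology_homeomorphic[OF _ perfect_S_D]
      perfect_topology_homeomorphic[OF _ perfect_S_1] perfect_topology_homeomorphic[OF _ perfect_S_2]
    by (elim disjE)
  then show ?thesis
    by (intro bexI[of _ S] conjI homeo Delta02_countable_TD[OF assms(4,5) S])
qed

end
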